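(* Let $K$ be a field, let $\alpha,\beta,\gamma,\delta\in K$ with $\alpha\neq 0$ and $\gamma\neq 0$, and let $f\in K[x]\setminus K$ be a nonconstant polynomial. Then $f(\alpha x+\beta)=\gamma f(x)+\delta$ holds if and only if one of the following holds: (0) $\alpha=\gamma=1$ and $\beta=\delta=0$ (with $f\in K[x]$ arbitrary); (1) $\alpha=\gamma=1$, $\beta\neq 0$, and $f=(\delta/\beta)x+r$, where $r\in K$ if $\mathrm{char}(K)=0$, and $r\in K[x^p-\beta^{p-1}x]$ if $\mathrm{char}(K)=p>0$; (2) $\alpha\neq 1$, $\gamma=\alpha^e$, and $f=f_0+f_1\bigl(x-\beta/(1-\alpha)\bigr)$, where $e,s\in\mathbb{Z}_{\ge 0}$, $f_1\in x^eK[x^s]$, $\alpha^s=1$, and $f_0\in K$ satisfies $\delta=(1-\gamma)f_0$.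
   Context: $K[x^p-\beta^{p-1}x]$ denotes the set of polynomials in the element $x^p-\beta^{p-1}x$ with coefficients in $K$; similarly $x^eK[x^s]$ denotes $\{x^e\phi(x^s):\phi\in K[x]\}$ (so $K[x^0]=K$). The expression $f_1(x-\beta/(1-\alpha))$ means the polynomial $f_1$ evaluated at $x-\beta/(1-\alpha)$. *)

theory Defs
  imports "HOL-Computational_Algebra.Computational_Algebra"
begin

text \<open>The set \<open>K\<close>, viewed as a subset of \<open>K[x]\<close>.\<close>

definition const_polys :: "'a::field poly set" where
  "const_polys = range (\<lambda>c. [:c:])"

text \<open>The set \<open>K[g]\<close> of polynomials in the element \<open>g\<close> of \<open>K[x]\<close>, with coefficients in \<open>K\<close>.\<close>

definition polys_in :: "'a::field poly \<Rightarrow> 'a poly set" where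
  "polys_in g = {\<phi> \<circ>\<^sub>p g | \<phi>. True}"

text \<open>The set \<open>x\<^sup>e K[x\<^sup>s]\<close>. For \<open>s = 0\<close> we have \<open>monom 1 0 = 1\<close>, so that \<open>K[x\<^sup>0] = K\<close>.\<close>

definition monom_times_polys_in :: "nat \<Rightarrow> nat \<Rightarrow> 'a::field poly set" where
  "monom_times_polys_in e s = {monom 1 e * h | h. h \<in> polys_in (monom 1 s)}"

end

theory Submission
  imports Defs
begin

text \<open>
  If \<open>\<alpha> = 1\<close>, comparing leading coefficients gives \<open>\<gamma> = 1\<close>, and subtracting \<open>(\<delta>/\<beta>) x\<close> reduces the
  equation to invariance under \<open>x \<mapsto> x + \<beta>\<close>. An invariant \<open>r\<close> takes the value \<open>r(0)\<close> at every
  \<open>i \<beta>\<close>: in characteristic 0 this makes \<open>r\<close> constant, and in characteristic \<open>p\<close> it makes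
  \<open>r - r(0)\<close> divisible by the invariant polynomial \<open>x\<^sup>p - \<beta>\<^bsup>p-1\<^esup> x\<close>; the quotient is again invariant
  and one proceeds by induction on the degree. If \<open>\<alpha> \<noteq> 1\<close>, moving the fixed point \<open>\<beta>/(1 - \<alpha>)\<close> of
  \<open>x \<mapsto> \<alpha> x + \<beta>\<close> to 0 turns the equation into \<open>\<alpha>\<^sup>i g\<^sub>i = \<gamma> g\<^sub>i\<close> for all \<open>i > 0\<close>, so the
  exponents of the nonconstant terms lie in one residue class modulo the order of \<open>\<alpha>\<close>.
\<close>

subsection \<open>Translations\<close>

lemma degree_pos_iff_not_const:
  fixes f :: "'a::field poly"
  shows "f \<notin> const_polys \<longleftrightarrow> degree f > 0"
proof -
  have "f \<in> const_polys \<longleftrightarrow> degree f = 0"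
    by (auto simp: const_polys_def elim: degree_eq_zeroE)
  then show ?thesis by simp
qed

lemma pcompose_power:
  fixes p q :: "'a::comm_semiring_1 poly"
  shows "(p ^ n) \<circ>\<^sub>p q = (p \<circ>\<^sub>p q) ^ n"
  by (induction n) (simp_all add: pcompose_1 pcompose_mult)

lemma poly_of_nat_mult_shift_invariant:
  fixes r :: "'a::field poly"
  assumes "r \<circ>\<^sub>p [:\<beta>, 1:] = r"
  shows "poly r (of_nat i * \<beta>) = poly r 0"
proof (induction i)
  case (Suc i)
  have "poly r (of_nat (Suc i) * \<beta>) = poly (r \<circ>\<^sub>p [:\<beta>, 1:]) (of_nat i * \<beta>)"
    by (simp add: poly_pcompose algebra_simps)
  then show ?case using Suc assms by simp
qed simp

text \<open>The \<open>degree g + 1\<close> points \<open>i * \<beta>\<close> with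
  \<open>i \<le> degree g\<close> are pairwise distinct, too many roots for a nonzero
  \<open>g\<close>. It is applied to \<open>r - r(0)\<close> in characteristic 0 and to a remainder
  modulo \<open>u\<close> in characteristic \<open>p\<close>.\<close>

lemma poly_eq_0_if_multiples_roots:
  fixes g :: "'a::field poly"
  assumes "\<beta> \<noteq> 0" and small: "CHAR('a) = 0 \<or> degree g < CHAR('a)"
    and roots: "\<And>i. poly g (of_nat i * \<beta>) = 0"
  shows "g = 0"
proof (rule ccontr)
  assume g: "g \<noteq> 0"
  have *: "of_nat i \<noteq> (of_nat j :: 'a)" if "i < j" "j \<le> degree g" for i j
  proof
    assume "of_nat i = (of_nat j :: 'a)"
    then have "of_nat (j - i) = (0 :: 'a)"
      using that by (simp add: of_nat_diff)
    \<comment> \<open>In characteristic 0 this forces \<open>j - i = 0\<close>; otherwise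
      \<open>0 < j - i \<le> degree g < CHAR('a)\<close> rules it out.\<close>
    then have "CHAR('a) dvd j - i"
      by (simp add: of_nat_eq_0_iff_char_dvd)
    then show False
      using that small by (auto dest: dvd_imp_le)
  qed
  have "inj_on (\<lambda>i. of_nat i * \<beta>) {..degree g}"
  proof (rule inj_onI)
    fix i j assume "i \<in> {..degree g}" "j \<in> {..degree g}" "of_nat i * \<beta> = of_nat j * \<beta>"
    then show "i = j"
      using *[of i j] *[of j i] \<open>\<beta> \<noteq> 0\<close> by (cases i j rule: linorder_cases) auto
  qed
  then have "card ((\<lambda>i. of_nat i * \<beta>) ` {..degree g}) = Suc (degree g)"
    by (simp add: card_image)
  moreover have "card ((\<lambda>i. of_nat i * \<beta>) ` {..degree g}) \<le> card {x. poly g x = 0}"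
    by (rule card_mono) (use g roots in \<open>auto simp: poly_roots_finite\<close>)
  ultimately show False
    using card_poly_roots_bound[OF g] by linarith
qed

lemma shift_invariant_char_0:
  fixes r :: "'a::field poly"
  assumes "\<beta> \<noteq> 0" "CHAR('a) = 0"
  shows "r \<circ>\<^sub>p [:\<beta>, 1:] = r \<longleftrightarrow> r \<in> const_polys"
proof
  assume "r \<circ>\<^sub>p [:\<beta>, 1:] = r"
  then have "r - [:poly r 0:] = 0"
    by (intro poly_eq_0_if_multiples_roots[of \<beta>])
       (use assms poly_of_nat_mult_shift_invariant in auto)
  then show "r \<in> const_polys"
    unfolding const_polys_def by (metis eq_iff_diff_eq_0 rangeI)
qed (auto simp: const_polys_def)

text \<open>For \<beta> nonzero, \<open>u\<close> is the product of the
  \<open>x - i * \<beta>\<close> over \<open>i < p\<close>, the monic polynomial whose roots are the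
  multiples of \<beta>.\<close>

context
  fixes \<beta> :: "'a::field" and p :: nat and u :: "'a poly"
  assumes p: "CHAR('a) = p" "p > 0"
  defines "u \<equiv> monom 1 p - monom (\<beta> ^ (p - 1)) 1"
begin

lemma prime_char: "prime p"
  using prime_CHAR_semidom[where 'a = 'a] p by simp

text \<open>By the Frobenius identity both terms of \<open>u\<close> gain the same constant
  \<open>\<beta> ^ p\<close>, which cancels in the difference.\<close>

lemma pcompose_shift_additive_poly: "u \<circ>\<^sub>p [:\<beta>, 1:] = u"
proof -
  have "[:\<beta>, 1:] ^ p = ([:\<beta>:] + monom 1 1) ^ p"
    by (simp add: monom_altdef)
  also have "\<dots> = [:\<beta>:] ^ p + monom 1 1 ^ p"
    by (rule freshmans_dream) (use prime_char p in auto)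
  also have "\<dots> = [:\<beta> ^ p:] + monom 1 p"
    by (simp add: monom_power poly_const_pow)
  finally have "monom 1 p \<circ>\<^sub>p [:\<beta>, 1:] = [:\<beta> ^ p:] + monom 1 p"
    by (simp add: monom_altdef pcompose_power pcompose_pCons)
  moreover have "monom (\<beta> ^ (p - 1)) 1 \<circ>\<^sub>p [:\<beta>, 1:] = [:\<beta> ^ p:] + monom (\<beta> ^ (p - 1)) 1"
    using p by (simp add: monom_altdef pcompose_pCons power_eq_if)
  ultimately show ?thesis
    by (simp add: u_def pcompose_diff)
qed

lemma degree_additive_poly: "degree u = p"
proof -
  \<comment> \<open>Primality gives \<open>p > 1\<close>, so the linear term cannot reach the degree
    of the leading one.\<close>
  have "degree (monom (\<beta> ^ (p - 1)) 1) < degree (monom (1::'a) p)"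
    using prime_gt_1_nat[OF prime_char] degree_monom_le[of "\<beta> ^ (p - 1)" 1]
    by (simp add: degree_monom_eq)
  then show ?thesis
    unfolding u_def diff_conv_add_uminus
    by (subst degree_add_eq_left) (simp_all add: degree_monom_eq)
qed

lemma polys_in_additive_poly_if_shift_invariant:
  assumes "\<beta> \<noteq> 0" "r \<circ>\<^sub>p [:\<beta>, 1:] = r"
  shows "r \<in> polys_in u"
  using assms(2)
proof (induction "degree r" arbitrary: r rule: less_induct)
  case less
  have u0: "u \<noteq> 0"
    using degree_additive_poly p by auto
  define g where "g = r - [:poly r 0:]"
  define q where "q = g div u"
  \<comment> \<open>Both \<open>g\<close> and \<open>u\<close> vanish at all multiples of \<beta>,
    hence so does the remainder, whose degree is below \<open>p\<close>.\<close>
  have "g mod u = 0"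
  proof (rule poly_eq_0_if_multiples_roots[OF \<open>\<beta> \<noteq> 0\<close>])
    show "CHAR('a) = 0 \<or> degree (g mod u) < CHAR('a)"
      using degree_mod_less[OF u0, of g] degree_additive_poly p by auto
    fix i
    have "poly u (of_nat i * \<beta>) = poly u 0"
      by (rule poly_of_nat_mult_shift_invariant[OF pcompose_shift_additive_poly])
    also have "\<dots> = 0"
      using p by (simp add: u_def poly_monom)
    finally have "poly u (of_nat i * \<beta>) = 0" .
    moreover have "poly g (of_nat i * \<beta>) = 0"
      using poly_of_nat_mult_shift_invariant[OF less.prems] by (simp add: g_def)
    moreover have "g mod u = g - u * q"
      by (simp add: q_def minus_mult_div_eq_mod)
    ultimately show "poly (g mod u) (of_nat i * \<beta>) = 0"
      by simp
  qed
  then have g: "g = u * q"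
    by (auto simp: q_def)
  have "g \<circ>\<^sub>p [:\<beta>, 1:] = g"
    by (simp add: g_def pcompose_diff less.prems)
  \<comment> \<open>Composing \<open>g = u * q\<close> with the shift fixes \<open>g\<close> and
    \<open>u\<close>; the factor \<open>u\<close> then cancels.\<close>
  then have q_inv: "q \<circ>\<^sub>p [:\<beta>, 1:] = q"
    using u0 by (simp add: g pcompose_mult pcompose_shift_additive_poly)
  have r: "r = [:poly r 0:] + u * q"
    using g by (simp add: g_def algebra_simps)
  show ?case
  proof (cases "q = 0")
    case True
    then have "r = [:poly r 0:] \<circ>\<^sub>p u"
      using r by (metis add_0_right mult_zero_right pcompose_const)
    then show ?thesis
      unfolding polys_in_def by blast
  next
    case False
    have "degree (u * q) = p + degree q"
      using u0 False degree_additive_poly by (simp add: degree_mult_eq)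
    then have "degree ([:poly r 0:] + u * q) = p + degree q"
      using p by (simp add: degree_add_eq_right)
    then have "degree q < degree r"
      using p r by simp
    then obtain \<phi> where "q = \<phi> \<circ>\<^sub>p u"
      using less.hyps[OF _ q_inv] unfolding polys_in_def by blast
    then have "r = pCons (poly r 0) \<phi> \<circ>\<^sub>p u"
      using r by (simp add: pcompose_pCons)
    then show ?thesis
      unfolding polys_in_def by blast
  qed
qed

lemma shift_invariant_char_pos:
  assumes "\<beta> \<noteq> 0"
  shows "r \<circ>\<^sub>p [:\<beta>, 1:] = r \<longleftrightarrow> r \<in> polys_in u"
proof
  assume "r \<in> polys_in u"
  then show "r \<circ>\<^sub>p [:\<beta>, 1:] = r"
    unfolding polys_in_def using pcompose_shift_additive_poly by (auto simp flip: pcompose_assoc)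
qed (rule polys_in_additive_poly_if_shift_invariant[OF assms])

end

text \<open>The equation is affine in \<open>f\<close>: the linear polynomial
  \<open>(\<delta> / \<beta>) x\<close> is a particular solution, and the homogeneous solutions are
  the shift invariants.\<close>

lemma pcompose_shift_eq_add_const_iff:
  fixes f :: "'a::field poly"
  assumes "\<beta> \<noteq> 0"
  shows "f \<circ>\<^sub>p [:\<beta>, 1:] = f + [:\<delta>:] \<longleftrightarrow>
    (\<exists>r. f = monom (\<delta> / \<beta>) 1 + r \<and>
       (CHAR('a) = 0 \<longrightarrow> r \<in> const_polys) \<and>
       (\<forall>p. CHAR('a) = p \<and> p > 0 \<longrightarrow> r \<in> polys_in (monom 1 p - monom (\<beta> ^ (p - 1)) 1)))"
    (is "_ \<longleftrightarrow> (\<exists>r. f = ?l + r \<and> ?P r)")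
proof -
  have inv: "r \<circ>\<^sub>p [:\<beta>, 1:] = r \<longleftrightarrow> ?P r" for r :: "'a poly"
    using shift_invariant_char_0[OF assms, of r] shift_invariant_char_pos[OF refl _ assms, of r]
    by (cases "CHAR('a) = 0") auto
  have l: "?l \<circ>\<^sub>p [:\<beta>, 1:] = ?l + [:\<delta>:]"
    using assms by (simp add: monom_altdef pcompose_pCons)
  have "f \<circ>\<^sub>p [:\<beta>, 1:] = f + [:\<delta>:] \<longleftrightarrow> (f - ?l) \<circ>\<^sub>p [:\<beta>, 1:] = f - ?l"
    unfolding pcompose_diff l diff_eq_eq by (simp add: add.commute)
  also have "\<dots> \<longleftrightarrow> ?P (f - ?l)"
    by (rule inv)
  also have "\<dots> \<longleftrightarrow> (\<exists>r. f = ?l + r \<and> ?P r)"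
    by (auto intro: exI[of _ "f - ?l"])
  finally show ?thesis .
qed

subsection \<open>Scalings\<close>

text \<open>This turns membership into a condition on the support, so that the scaling equation can
  be treated coefficient by coefficient.\<close>

lemma monom_times_polys_in_iff:
  fixes h :: "'a::field poly"
  shows "h \<in> monom_times_polys_in e s \<longleftrightarrow> (\<forall>i. coeff h i \<noteq> 0 \<longrightarrow> (\<exists>k. i = e + s * k))"
proof -
  have comp: "monom c k \<circ>\<^sub>p monom 1 s = monom c (s * k)" for c :: 'a and k
    by (simp add: monom_altdef[of c] pcompose_smult pcompose_power monom_power
        pcompose_pCons smult_monom)
  show ?thesis
  proof
    assume "h \<in> monom_times_polys_in e s"
    then obtain \<phi> where h: "h = monom 1 e * (\<phi> \<circ>\<^sub>p monom 1 s)"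
      unfolding monom_times_polys_in_def polys_in_def by blast
    have "h = monom 1 e * ((\<Sum>k\<le>degree \<phi>. monom (coeff \<phi> k) k) \<circ>\<^sub>p monom 1 s)"
      by (simp add: h poly_as_sum_of_monoms)
    also have "\<dots> = (\<Sum>k\<le>degree \<phi>. monom (coeff \<phi> k) (e + s * k))"
      by (simp add: pcompose_sum comp sum_distrib_left mult_monom)
    finally have "coeff h i = (\<Sum>k\<le>degree \<phi>. coeff (monom (coeff \<phi> k) (e + s * k)) i)" for i
      by (simp add: coeff_sum)
    then show "\<forall>i. coeff h i \<noteq> 0 \<longrightarrow> (\<exists>k. i = e + s * k)"
      by (metis (no_types, lifting) coeff_monom sum.neutral)
  next
    assume *: "\<forall>i. coeff h i \<noteq> 0 \<longrightarrow> (\<exists>k. i = e + s * k)"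
    \<comment> \<open>Each term of \<open>h\<close> is written in the required form separately; the
      resulting \<open>c i\<close> are then summed.\<close>
    have "\<exists>c. monom (coeff h i) i = monom 1 e * (c \<circ>\<^sub>p monom 1 s)" for i
    proof (cases "coeff h i = 0")
      case True
      then show ?thesis by (intro exI[of _ 0]) simp
    next
      case False
      then obtain k where "i = e + s * k" using * by blast
      then show ?thesis
        by (intro exI[of _ "monom (coeff h i) k"]) (simp add: comp mult_monom)
    qed
    then obtain c where c: "\<And>i. monom (coeff h i) i = monom 1 e * (c i \<circ>\<^sub>p monom 1 s)"
      by metis
    have "h = (\<Sum>i\<le>degree h. monom (coeff h i) i)"
      by (simp add: poly_as_sum_of_monoms)
    also have "\<dots> = monom 1 e * ((\<Sum>i\<le>degree h. c i) \<circ>\<^sub>p monom 1 s)"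
      by (simp only: c pcompose_sum sum_distrib_left)
    finally show "h \<in> monom_times_polys_in e s"
      unfolding monom_times_polys_in_def polys_in_def by blast
  qed
qed

text \<open>For \<open>\<alpha>\<close> of infinite order the witness is \<open>s = 0\<close>.\<close>

lemma obtain_order:
  fixes \<alpha> :: "'a::field"
  obtains s :: nat where "\<And>n. \<alpha> ^ n = 1 \<longleftrightarrow> s dvd n"
proof (cases "\<exists>n>0. \<alpha> ^ n = 1")
  case False
  then show ?thesis
    by (intro that[of 0]) auto
next
  case True
  define s where "s = (LEAST n. n > 0 \<and> \<alpha> ^ n = 1)"
  have s: "s > 0" "\<alpha> ^ s = 1"
    using LeastI_ex[OF True] by (auto simp: s_def)
  have "\<alpha> ^ n = 1 \<longleftrightarrow> s dvd n" for n
  proof -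
    have "\<alpha> ^ n = \<alpha> ^ (n mod s)"
      by (metis div_mult_mod_eq mult.commute mult_1 power_add power_mult power_one s(2))
    \<comment> \<open>As \<open>n mod s < s\<close>, minimality of \<open>s\<close> excludes a
      positive remainder.\<close>
    moreover have "\<alpha> ^ (n mod s) = 1 \<longleftrightarrow> n mod s = 0"
      using not_less_Least[of "n mod s" "\<lambda>n. n > 0 \<and> \<alpha> ^ n = 1"] s(1)
      by (auto simp flip: s_def)
    ultimately show ?thesis
      by (simp add: dvd_eq_mod_eq_0)
  qed
  then show ?thesis by (rule that)
qed

lemma pcompose_scale_eq_iff:
  fixes g :: "'a::field poly"
  assumes "\<alpha> \<noteq> 0" "degree g > 0"
  shows "g \<circ>\<^sub>p [:0, \<alpha>:] = smult \<gamma> g + [:\<delta>:] \<longleftrightarrow>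
    (\<exists>e s f1 f0. \<gamma> = \<alpha> ^ e \<and> g = [:f0:] + f1 \<and>
       f1 \<in> monom_times_polys_in e s \<and> \<alpha> ^ s = 1 \<and> \<delta> = (1 - \<gamma>) * f0)"
    (is "?L \<longleftrightarrow> ?R")
proof
  assume ?L
  then have cf: "\<alpha> ^ i * coeff g i = \<gamma> * coeff g i + coeff [:\<delta>:] i" for i
    by (metis coeff_add coeff_pcompose_linear coeff_smult)
  have eig: "\<alpha> ^ i = \<gamma>" if "i > 0" "coeff g i \<noteq> 0" for i
    using cf[of i] that by (simp add: coeff_pCons split: nat.splits)
  \<comment> \<open>Taking the least positive exponent ensures \<open>e \<le> i\<close> for every
    nonconstant term of \<open>g\<close>, so \<open>i - e\<close> is a true difference.\<close>
  define e where "e = (LEAST i. i > 0 \<and> \<alpha> ^ i = \<gamma>)"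
  have "\<exists>i>0. \<alpha> ^ i = \<gamma>"
    using eig[of "degree g"] assms(2) by fastforce
  then have e: "e > 0" "\<alpha> ^ e = \<gamma>"
    using LeastI_ex[of "\<lambda>i. i > 0 \<and> \<alpha> ^ i = \<gamma>"] by (auto simp: e_def)
  obtain s where s: "\<And>n. \<alpha> ^ n = 1 \<longleftrightarrow> s dvd n"
    using obtain_order[of \<alpha>] by blast
  \<comment> \<open>The constant coefficient is split off because only there \<delta> enters; it
    serves as \<open>f0\<close>.\<close>
  define f1 where "f1 = g - [:coeff g 0:]"
  have "f1 \<in> monom_times_polys_in e s"
    unfolding monom_times_polys_in_iff
  proof (intro allI impI)
    fix i assume "coeff f1 i \<noteq> 0"
    then have i: "i > 0" "coeff g i \<noteq> 0"
      by (auto simp: f1_def coeff_pCons split: nat.splits)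
    then have "e \<le> i"
      unfolding e_def using eig by (intro Least_le) auto
    have "\<alpha> ^ (i - e) = 1"
      using eig[OF i] e(2) assms(1) \<open>e \<le> i\<close> by (auto simp: power_diff)
    then obtain k where "i - e = s * k"
      using s by (auto elim: dvdE)
    then show "\<exists>k. i = e + s * k"
      using \<open>e \<le> i\<close> by (intro exI[of _ k]) simp
  qed
  moreover have "\<delta> = (1 - \<gamma>) * coeff g 0"
    using cf[of 0] by (simp add: algebra_simps)
  moreover have "g = [:coeff g 0:] + f1" "\<alpha> ^ s = 1"
    using s by (auto simp: f1_def)
  ultimately show ?R
    using e(2) by blast
next
  assume ?R
  then obtain e s f1 f0 where *: "\<gamma> = \<alpha> ^ e" "g = [:f0:] + f1"
    "f1 \<in> monom_times_polys_in e s" "\<alpha> ^ s = 1" "\<delta> = (1 - \<gamma>) * f0"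
    by blast
  \<comment> \<open>On the support of \<open>f1\<close>, \<open>\<alpha> ^ (e + s * k) = \<gamma> *
    (\<alpha> ^ s) ^ k = \<gamma>\<close>.\<close>
  have "\<alpha> ^ i * coeff f1 i = \<gamma> * coeff f1 i" for i
  proof (cases "coeff f1 i = 0")
    case False
    then obtain k where "i = e + s * k"
      using *(3) unfolding monom_times_polys_in_iff by blast
    then show ?thesis
      using * by (simp add: power_add power_mult)
  qed simp
  then have "f1 \<circ>\<^sub>p [:0, \<alpha>:] = smult \<gamma> f1"
    by (intro poly_eqI) (simp add: coeff_pcompose_linear)
  then show ?L
    using * by (simp add: pcompose_add smult_add_right algebra_simps)
qed

text \<open>Here \<open>c\<close> is the fixed point of
  \<open>x \<mapsto> \<alpha> x + \<beta>\<close>. Translating by \<open>c\<close> conjugates this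
  map to \<open>x \<mapsto> \<alpha> x\<close>, and composing with a translation is
  injective.\<close>

lemma pcompose_affine_eq_iff_conjugate:
  fixes f :: "'a::field poly"
  assumes "\<alpha> \<noteq> 1" and c: "c = \<beta> / (1 - \<alpha>)"
  shows "f \<circ>\<^sub>p [:\<beta>, \<alpha>:] = smult \<gamma> f + [:\<delta>:] \<longleftrightarrow>
    (f \<circ>\<^sub>p [:c, 1:]) \<circ>\<^sub>p [:0, \<alpha>:] = smult \<gamma> (f \<circ>\<^sub>p [:c, 1:]) + [:\<delta>:]"
proof -
  have fix_c: "\<alpha> * c + \<beta> = c"
    using assms by (simp add: field_simps)
  \<comment> \<open>Both sides are \<open>f(\<alpha> x + c)\<close>, since
    \<open>\<alpha> (x + c) + \<beta> = \<alpha> x + c\<close>.\<close>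
  have "(f \<circ>\<^sub>p [:c, 1:]) \<circ>\<^sub>p [:0, \<alpha>:] = (f \<circ>\<^sub>p [:\<beta>, \<alpha>:]) \<circ>\<^sub>p [:c, 1:]"
    using fix_c by (simp add: pcompose_pCons algebra_simps flip: pcompose_assoc)
  moreover have "smult \<gamma> (f \<circ>\<^sub>p [:c, 1:]) + [:\<delta>:] = (smult \<gamma> f + [:\<delta>:]) \<circ>\<^sub>p [:c, 1:]"
    by (simp add: pcompose_add pcompose_smult)
  moreover have "p \<circ>\<^sub>p [:c, 1:] = q \<circ>\<^sub>p [:c, 1:] \<longleftrightarrow> p = q" for p q :: "'a poly"
    using pcompose_eq_0_iff[of "[:c, 1:]" "p - q"] by (simp add: pcompose_diff)
  ultimately show ?thesis
    by simp
qed

lemma pcompose_shift_eq_iff: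
  fixes f g :: "'a::field poly"
  shows "f \<circ>\<^sub>p [:c, 1:] = g \<longleftrightarrow> f = g \<circ>\<^sub>p [:-c, 1:]"
  by (auto simp: pcompose_pCons simp flip: pcompose_assoc)

theorem theorem1p1:
  fixes \<alpha> \<beta> \<gamma> \<delta> :: "'a::field" and f :: "'a poly"
  assumes "\<alpha> \<noteq> 0" and "\<gamma> \<noteq> 0" and "f \<notin> const_polys"
  shows "f \<circ>\<^sub>p [:\<beta>, \<alpha>:] = smult \<gamma> f + [:\<delta>:] \<longleftrightarrow>
    (\<alpha> = 1 \<and> \<gamma> = 1 \<and> \<beta> = 0 \<and> \<delta> = 0) \<or>
    (\<alpha> = 1 \<and> \<gamma> = 1 \<and> \<beta> \<noteq> 0 \<and>
      (\<exists>r. f = monom (\<delta> / \<beta>) 1 + r \<and>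
           (CHAR('a) = 0 \<longrightarrow> r \<in> const_polys) \<and>
           (\<forall>p. CHAR('a) = p \<and> p > 0 \<longrightarrow> r \<in> polys_in (monom 1 p - monom (\<beta> ^ (p - 1)) 1)))) \<or>
    (\<alpha> \<noteq> 1 \<and>
      (\<exists>(e::nat) (s::nat) f1 f0.
           \<gamma> = \<alpha> ^ e \<and> f = [:f0:] + f1 \<circ>\<^sub>p [:- (\<beta> / (1 - \<alpha>)), 1:] \<and>
           f1 \<in> monom_times_polys_in e s \<and> \<alpha> ^ s = 1 \<and> \<delta> = (1 - \<gamma>) * f0))"
proof (cases "\<alpha> = 1")
  case False
  define c where "c = \<beta> / (1 - \<alpha>)"
  have "degree f > 0"
    using assms(3) by (simp add: degree_pos_iff_not_const)
  then have "f \<circ>\<^sub>p [:\<beta>, \<alpha>:] = smult \<gamma> f + [:\<delta>:] \<longleftrightarrow>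
    (\<exists>e s f1 f0. \<gamma> = \<alpha> ^ e \<and> f \<circ>\<^sub>p [:c, 1:] = [:f0:] + f1 \<and>
       f1 \<in> monom_times_polys_in e s \<and> \<alpha> ^ s = 1 \<and> \<delta> = (1 - \<gamma>) * f0)"
    unfolding pcompose_affine_eq_iff_conjugate[OF False c_def]
    by (intro pcompose_scale_eq_iff) (use assms(1) in \<open>auto simp: degree_pcompose\<close>)
  then show ?thesis
    using False by (simp add: pcompose_shift_eq_iff pcompose_add c_def)
next
  case True
  \<comment> \<open>A translation keeps the leading coefficient, and \<delta> affects only degree 0,
    below the degree of the nonconstant \<open>f\<close>.\<close>
  have "\<gamma> = 1" if eq: "f \<circ>\<^sub>p [:\<beta>, \<alpha>:] = smult \<gamma> f + [:\<delta>:]"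
  proof -
    have deg: "degree f > 0"
      using assms(3) by (simp add: degree_pos_iff_not_const)
    then have "lead_coeff f = coeff (f \<circ>\<^sub>p [:\<beta>, \<alpha>:]) (degree f)"
      using lead_coeff_comp[of "[:\<beta>, \<alpha>:]" f] True by (simp add: degree_pcompose)
    also have "\<dots> = \<gamma> * lead_coeff f"
      using deg by (simp add: eq coeff_pCons split: nat.splits)
    finally show ?thesis
      using deg by auto
  qed
  moreover have "f \<circ>\<^sub>p [:\<beta>, \<alpha>:] = smult \<gamma> f + [:\<delta>:] \<longleftrightarrow> \<delta> = 0" if "\<gamma> = 1" "\<beta> = 0"
    using that True by simp
  moreover note pcompose_shift_eq_add_const_iff[of \<beta> f \<delta>]
  ultimately show ?thesis
    using True by (cases "\<gamma> = 1"; cases "\<beta> = 0") auto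
qed

end
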